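(* Let $N\in\mathbb{N}$ and let $\Phi=(f_n\mid n\ge 2)$ be a sequence of functions $f_n:\mathbb{N}^{n-1}\to\mathbb{N}$. For every finite coloring $\mathbb{N}=C_1\cup\ldots\cup C_r$ and for every non-trivial multiplicatively closed subset $X\subseteq\mathbb{N}$, there exist an increasing sequence $(a_n)_{n\in\mathbb{N}}$ of natural numbers and an index $i\in\{1,\ldots,r\}$ such that $\mathrm{FE}_{N,\Phi}(a_n)_{n=1}^\infty\subseteq X\cap C_i$.
   Context: $\mathbb{N}$ denotes the set of positive integers. A finite coloring is a finite partition. A multiplicatively closed set $X\subseteq\mathbb{N}$ is non-trivial if $X\neq\emptyset$ and $X\ne\{1\}$. "Increasing" means strictly increasing. For a sequence $(a_n)_{n\in\mathbb{N}}$ of natural numbers, $N\in\mathbb{N}$ and $\Phi=(f_n\mid n\ge2)$ with $f_n:\mathbb{N}^{n-1}\to\mathbb{N}$, define $\mathrm{EXP}_{N,\Phi}(a_1)=\{a_1\}$ and, for $k\ge2$, $$\mathrm{EXP}_{N,\Phi}(a_1,\ldots,a_k)=\left\{a_k^{\prod_{t=1}^{k-1}a_t^{\lambda_t}}\ \Big|\ 0\le\lambda_1\le N,\ 0\le\lambda_t\le f_t(a_1,\ldots,a_{t-1})\text{ for }2\le t\le k-1\right\},$$ where the $\lambda_t$ are integers, and $\mathrm{FE}_{N,\Phi}(a_n)_{n=1}^\infty=\bigcup_{k=1}^\infty\mathrm{EXP}_{N,\Phi}(a_1,\ldots,a_k)$. *)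

theory Defs
  imports Main "HOL-Library.FuncSet" "HOL-Library.Disjoint_Sets"
begin

abbreviation pos_nats :: "nat set" where
  "pos_nats \<equiv> {0<..}"

text \<open>A sequence \<open>(f\<^sub>n | n \<ge> 2)\<close> with \<open>f\<^sub>n\<close> of arity \<open>n - 1\<close> is encoded as
  \<open>f :: nat \<Rightarrow> nat list \<Rightarrow> nat\<close>: the value of \<open>f\<^sub>n\<close> at \<open>(x\<^sub>1, \<dots>, x\<^sub>m)\<close> with \<open>m = n - 1\<close>
  is \<open>f n [x\<^sub>1, \<dots>, x\<^sub>m]\<close>.  Values of \<open>f\<close> elsewhere are irrelevant.\<close>
definition function_sequence :: "(nat \<Rightarrow> nat list \<Rightarrow> nat) \<Rightarrow> bool" where
  "function_sequence f \<longleftrightarrow>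
     (\<forall>n\<ge>2. f n \<in> {xs. length xs = n - 1 \<and> set xs \<subseteq> pos_nats} \<rightarrow> pos_nats)"

text \<open>Sequences are indexed by the positive integers; the value \<open>a 0\<close> is never used.
  \<open>EXP N f a k\<close> is the set associated with the initial segment \<open>(a 1, \<dots>, a k)\<close>.\<close>
definition EXP ::
  "nat \<Rightarrow> (nat \<Rightarrow> nat list \<Rightarrow> nat) \<Rightarrow> (nat \<Rightarrow> nat) \<Rightarrow> nat \<Rightarrow> nat set" where
  "EXP N f a k =
     (if k = 1 then {a 1}
      else {a k ^ (\<Prod>t\<in>{1..k-1}. a t ^ l t) | l :: nat \<Rightarrow> nat.
              l 1 \<le> N \<and> (\<forall>t\<in>{2..k-1}. l t \<le> f t (map a [1..<t]))})"

definition FE :: "nat \<Rightarrow> (nat \<Rightarrow> nat list \<Rightarrow> nat) \<Rightarrow> (nat \<Rightarrow> nat) \<Rightarrow> nat set" where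
  "FE N f a = (\<Union>k\<in>{1..}. EXP N f a k)"

text \<open>Colour classes are allowed to be empty.\<close>
definition finite_coloring :: "nat \<Rightarrow> (nat \<Rightarrow> nat set) \<Rightarrow> bool" where
  "finite_coloring r C \<longleftrightarrow> (\<Union>i\<in>{1..r}. C i) = pos_nats \<and> disjoint_family_on C {1..r}"

definition mult_closed :: "nat set \<Rightarrow> bool" where
  "mult_closed X \<longleftrightarrow> (\<forall>x\<in>X. \<forall>y\<in>X. x * y \<in> X)"

definition nontrivial :: "nat set \<Rightarrow> bool" where
  "nontrivial X \<longleftrightarrow> X \<noteq> {} \<and> X \<noteq> {1}"

end

theory Submission
  imports Defs "HOL-Library.Countable"
begin

text \<open>
  A non-trivial multiplicatively closed \<open>X\<close> contains every positive power of some \<open>x \<ge> 2\<close>, so one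
  looks for \<open>a\<^sub>k = x ^ b\<^sub>k\<close>.  Then an element of the exponential set with last base \<open>a\<^sub>k\<close> is
  \<open>x ^ (b\<^sub>k * x ^ e)\<close> with \<open>e = (\<Sum>t<k. \<lambda>\<^sub>t * b\<^sub>t)\<close>.  If \<open>\<chi> y\<close> denotes the colour of \<open>x ^ y\<close>, then all the
  numbers \<open>b\<^sub>k * x ^ e\<close> must have the same colour under \<open>\<chi>\<close>.

  The terms are sought in the form \<open>b\<^sub>k = x ^ m\<^sub>k * n\<^sub>k\<close>, so that \<open>b\<^sub>k * x ^ e = x ^ (m\<^sub>k + e) * n\<^sub>k\<close>:
  multiplication by \<open>x ^ e\<close> has become a translation of \<open>m\<^sub>k\<close>.  Suppose that the colour of
  \<open>x ^ m * n\<close> depended only on \<open>m\<close>, say \<open>\<chi> (x ^ m * n) = c m\<close>.  Some class \<open>A = {m. c m = i}\<close> is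
  piecewise syndetic, and it would be enough to have \<open>m\<^sub>k + e \<in> A\<close> for the finitely many
  possible \<open>e\<close>.  This is maintained by keeping the set of all admissible \<open>m\<close> piecewise syndetic: a
  new term \<open>b\<close> replaces an admissible set \<open>B\<close> by \<open>{z. \<forall>\<lambda>\<le>L. z + \<lambda> * b \<in> B}\<close>, and by van der
  Waerden's theorem there are numbers \<open>n\<close> for which this set, with \<open>b = x ^ m * n\<close>, is again
  piecewise syndetic (\<open>common_return_time\<close>).  The bound \<open>L\<close> may depend on all previous terms, as
  it is known before \<open>b\<close> is chosen.

  The numbers \<open>n\<close> must also make the colour of \<open>x ^ m * n\<close> depend on \<open>m\<close> only.  For this, van der
  Waerden's theorem is used for several piecewise syndetic sets at a time.  The sets \<open>S\<close> that
  contain a common return time for each finite family of piecewise syndetic sets are partition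
  regular (\<open>recurrent_Un\<close>), and \<open>UNIV\<close> is one of them.  Hence there is a decreasing sequence of such sets \<open>S\<^sub>m\<close> with
  \<open>\<chi> (x ^ j * n) = c j\<close> for all \<open>j < m\<close> and \<open>n \<in> S\<^sub>m\<close>.  A single step of the construction looks at
  only finitely many values of \<open>m\<close>, so it can take \<open>n\<close> from one of these sets.  The nested
  sequence does here what an ultrafilter of return times would do.
\<close>

section \<open>Van der Waerden's theorem\<close>

text \<open>The colourings are defined on all of the natural numbers, and only the start and the
  difference of the progression are bounded; so translates of a colouring need no bookkeeping of
  domains.\<close>

definition vdw_bound :: "nat \<Rightarrow> nat set \<Rightarrow> nat \<Rightarrow> bool" where
  "vdw_bound L K W \<longleftrightarrow> (\<forall>c :: nat \<Rightarrow> nat. range c \<subseteq> K \<longrightarrow>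
     (\<exists>x\<le>W. \<exists>n\<in>{1..W}. \<forall>k\<le>L. c (x + k * n) = c x))"

text \<open>Colour focusing: \<open>Q\<close> is a set of \<open>s\<close> colours such that each one occurs on a progression
  \<open>y + n, y + 2n, \<dots>, y + (L + 1)n\<close> with the common focus \<open>y\<close>.  For the step from \<open>s\<close> to
  \<open>s + 1\<close>, the assumption on progressions of length \<open>L + 1\<close> is applied to the colouring
  of points by whole blocks.  It yields equal blocks at \<open>x\<^sub>0 + n, \<dots>, x\<^sub>0 + (L + 1)n\<close>; adding \<open>n\<close> to
  the differences found inside the block moves the focus to \<open>x\<^sub>0 + y\<close>, and the copies of the old
  focus form one more progression.  If its colour is not new, then an old progression extends.\<close>

lemma colour_focusing:
  assumes vdw: "\<And>K :: nat set. finite K \<Longrightarrow> \<exists>W. vdw_bound L K W" and fin: "finite K"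
  shows "\<exists>W. \<forall>c :: nat \<Rightarrow> nat. range c \<subseteq> K \<longrightarrow>
     (\<exists>x\<le>W. \<exists>n\<in>{1..W}. \<forall>k\<le>Suc L. c (x + k * n) = c x) \<or>
     (\<exists>y\<le>W. \<exists>Q\<subseteq>K. card Q = s \<and> (\<forall>q\<in>Q. \<exists>n\<in>{1..W}. \<forall>k\<in>{1..Suc L}. c (y + k * n) = q))"
proof (induction s)
  case 0
  show ?case by (intro exI[of _ 0]) (auto intro!: exI[of _ "{}"])
next
  case (Suc s)
  then obtain W where W: "\<And>c :: nat \<Rightarrow> nat. range c \<subseteq> K \<Longrightarrow>
     (\<exists>x\<le>W. \<exists>n\<in>{1..W}. \<forall>k\<le>Suc L. c (x + k * n) = c x) \<or>
     (\<exists>y\<le>W. \<exists>Q\<subseteq>K. card Q = s \<and> (\<forall>q\<in>Q. \<exists>n\<in>{1..W}. \<forall>k\<in>{1..Suc L}. c (y + k * n) = q))"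
    by blast
  define w where "w = Suc (W + Suc L * W)"
  define K' where "K' = (to_nat :: nat list \<Rightarrow> nat) ` {xs. set xs \<subseteq> K \<and> length xs = w}"
  have "finite K'" unfolding K'_def using finite_lists_length_eq[OF fin] by blast
  with vdw obtain V where V: "vdw_bound L K' V" by blast
  define U where "U = 3 * V + W"
  show ?case
  proof (intro exI[of _ U] allI impI)
    fix c :: "nat \<Rightarrow> nat" assume c: "range c \<subseteq> K"
    \<comment> \<open>The shift by \<open>V\<close> makes room for the focus, which lies one step before the first block.\<close>
    define d where "d = (\<lambda>z. to_nat (map (\<lambda>i. c (V + z + i)) [0..<w]))"
    have "map (\<lambda>i. c (V + z + i)) [0..<w] \<in> {xs. set xs \<subseteq> K \<and> length xs = w}" for z
      using c by auto
    then have "range d \<subseteq> K'" unfolding d_def K'_def by blast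
    with V obtain x n where x: "x \<le> V" and n: "n \<in> {1..V}"
      and dd: "\<And>k. k \<le> L \<Longrightarrow> d (x + k * n) = d x"
      unfolding vdw_bound_def by blast
    define x0 where "x0 = V + x - n"
    have x0: "V + x = x0 + n" and x0_le: "x0 \<le> 2 * V" using n x by (auto simp: x0_def)
    have block: "c (x0 + k * n + i) = c (x0 + n + i)" if k: "k \<in> {1..Suc L}" and i: "i < w" for k i
    proof -
      from k obtain j where j: "k = Suc j" "j \<le> L" by (cases k) auto
      have "c (V + (x + j * n) + i) = c (V + x + i)"
        using dd[OF j(2)] i by (auto simp: d_def list_eq_iff_nth_eq)
      moreover have "V + (x + j * n) = x0 + k * n" using x0 j by simp
      ultimately show ?thesis using x0 by simp
    qed
    have "range (\<lambda>i. c (x0 + n + i)) \<subseteq> K" using c by auto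
    from W[OF this] consider
        (mono) y m where "y \<le> W" "m \<in> {1..W}" "\<And>k. k \<le> Suc L \<Longrightarrow> c (x0 + n + (y + k * m)) = c (x0 + n + y)"
      | (focus) y Q where "y \<le> W" "Q \<subseteq> K" "card Q = s"
          "\<And>q. q \<in> Q \<Longrightarrow> \<exists>m\<in>{1..W}. \<forall>k\<in>{1..Suc L}. c (x0 + n + (y + k * m)) = q"
      by blast
    then show "(\<exists>x\<le>U. \<exists>n\<in>{1..U}. \<forall>k\<le>Suc L. c (x + k * n) = c x) \<or>
      (\<exists>y\<le>U. \<exists>Q\<subseteq>K. card Q = Suc s \<and> (\<forall>q\<in>Q. \<exists>n\<in>{1..U}. \<forall>k\<in>{1..Suc L}. c (y + k * n) = q))"
    proof cases
      case mono
      have "x0 + n + y \<le> U" "m \<in> {1..U}" using mono(1,2) n x0_le by (auto simp: U_def)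
      then show ?thesis using mono(3) by (metis add.assoc)
    next
      case focus
      define q0 where "q0 = c (x0 + n + y)"
      show ?thesis
      proof (cases "q0 \<in> Q")
        case True
        then obtain m where m: "m \<in> {1..W}" "\<And>k. k \<in> {1..Suc L} \<Longrightarrow> c (x0 + n + (y + k * m)) = q0"
          using focus(4) by blast
        have "c (x0 + n + y + k * m) = c (x0 + n + y)" if "k \<le> Suc L" for k
          using m(2)[of k] that by (cases "k = 0") (auto simp: q0_def add.assoc)
        moreover have "x0 + n + y \<le> U" "m \<in> {1..U}" using focus(1) m(1) n x0_le by (auto simp: U_def)
        ultimately show ?thesis by blast
      next
        case False
        have "finite Q" using focus(2) fin finite_subset by blast
        then have card: "card (insert q0 Q) = Suc s" using False focus(3) by simp
        have sub: "insert q0 Q \<subseteq> K" using focus(2) c by (auto simp: q0_def)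
        have "\<exists>m\<in>{1..U}. \<forall>k\<in>{1..Suc L}. c (x0 + y + k * m) = q" if q: "q \<in> insert q0 Q" for q
        proof (cases "q = q0")
          case True
          have "c (x0 + y + k * n) = q" if k: "k \<in> {1..Suc L}" for k
            using block[OF k, of y] focus(1) True by (simp add: w_def q0_def ac_simps)
          then show ?thesis using n by (intro bexI[of _ n]) (auto simp: U_def)
        next
          case False
          then obtain m where m: "m \<in> {1..W}" "\<And>k. k \<in> {1..Suc L} \<Longrightarrow> c (x0 + n + (y + k * m)) = q"
            using q focus(4)[of q] by blast
          have "c (x0 + y + k * (m + n)) = q" if k: "k \<in> {1..Suc L}" for k
          proof -
            have "k * m \<le> Suc L * W" using k m(1) by (intro mult_mono) auto
            then have "y + k * m < w" using focus(1) by (simp add: w_def)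
            from block[OF k this] show ?thesis
              using m(2)[OF k] by (simp add: algebra_simps)
          qed
          then show ?thesis using m(1) n by (intro bexI[of _ "m + n"]) (auto simp: U_def)
        qed
        moreover have "x0 + y \<le> U" using focus(1) x0_le by (simp add: U_def)
        ultimately show ?thesis using card sub by blast
      qed
    qed
  qed
qed

theorem van_der_Waerden:
  assumes "finite K"
  shows "\<exists>W. vdw_bound L K W"
  using assms
proof (induction L arbitrary: K)
  case 0
  show ?case by (intro exI[of _ 1]) (auto simp: vdw_bound_def intro!: exI[of _ 0])
next
  case (Suc L)
  \<comment> \<open>With as many focused progressions as colours, the colour of the focus itself is among theirs.\<close>
  obtain W where W: "\<And>c :: nat \<Rightarrow> nat. range c \<subseteq> K \<Longrightarrow>
     (\<exists>x\<le>W. \<exists>n\<in>{1..W}. \<forall>k\<le>Suc L. c (x + k * n) = c x) \<or>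
     (\<exists>y\<le>W. \<exists>Q\<subseteq>K. card Q = card K \<and> (\<forall>q\<in>Q. \<exists>n\<in>{1..W}. \<forall>k\<in>{1..Suc L}. c (y + k * n) = q))"
    using colour_focusing[OF Suc.IH Suc.prems, where s = "card K"] by blast
  have "\<exists>x\<le>W. \<exists>n\<in>{1..W}. \<forall>k\<le>Suc L. c (x + k * n) = c x" if c: "range c \<subseteq> K" for c :: "nat \<Rightarrow> nat"
    using W[OF c]
  proof
    assume "\<exists>y\<le>W. \<exists>Q\<subseteq>K. card Q = card K \<and> (\<forall>q\<in>Q. \<exists>n\<in>{1..W}. \<forall>k\<in>{1..Suc L}. c (y + k * n) = q)"
    then obtain y Q where y: "y \<le> W" and Q: "Q \<subseteq> K" "card Q = card K"
      and foc: "\<And>q. q \<in> Q \<Longrightarrow> \<exists>n\<in>{1..W}. \<forall>k\<in>{1..Suc L}. c (y + k * n) = q" by blast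
    have "Q = K" using card_subset_eq[OF Suc.prems Q] .
    with foc c obtain n where n: "n \<in> {1..W}" "\<And>k. k \<in> {1..Suc L} \<Longrightarrow> c (y + k * n) = c y" by blast
    have "c (y + k * n) = c y" if "k \<le> Suc L" for k
      using n(2)[of k] that by (cases "k = 0") auto
    then show ?thesis using y n(1) by blast
  qed
  then show ?case unfolding vdw_bound_def by blast
qed

section \<open>Piecewise syndetic sets\<close>

definition piecewise_syndetic :: "nat set \<Rightarrow> bool" where
  "piecewise_syndetic A \<longleftrightarrow> (\<exists>k. \<forall>l. \<exists>x. \<forall>y\<in>{x..<x+l}. \<exists>j<k. y + j \<in> A)"

lemma piecewise_syndetic_UNIV: "piecewise_syndetic UNIV"
  unfolding piecewise_syndetic_def by (intro exI[of _ 1]) auto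

lemma piecewise_syndetic_mono:
  "piecewise_syndetic A \<Longrightarrow> A \<subseteq> B \<Longrightarrow> piecewise_syndetic B"
  unfolding piecewise_syndetic_def by (meson subsetD)

lemma piecewise_syndetic_translate:
  assumes "piecewise_syndetic A"
  shows "piecewise_syndetic ((\<lambda>x. x + t) ` A)"
proof -
  obtain k where k: "\<And>l. \<exists>x. \<forall>y\<in>{x..<x+l}. \<exists>j<k. y + j \<in> A"
    using assms unfolding piecewise_syndetic_def by blast
  have "\<exists>x. \<forall>y\<in>{x..<x+l}. \<exists>j<k. y + j \<in> (\<lambda>x. x + t) ` A" for l
  proof -
    obtain x where x: "\<And>y. y \<in> {x..<x+l} \<Longrightarrow> \<exists>j<k. y + j \<in> A" using k by blast
    have "\<exists>j<k. y + j \<in> (\<lambda>x. x + t) ` A" if y: "y \<in> {x+t..<x+t+l}" for y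
    proof -
      have "y - t \<in> {x..<x+l}" using y by auto
      from x[OF this] obtain j where j: "j < k" "y - t + j \<in> A" by blast
      have "y + j = (y - t + j) + t" using y by auto
      with j show ?thesis by blast
    qed
    then show ?thesis by blast
  qed
  then show ?thesis unfolding piecewise_syndetic_def by blast
qed

lemma piecewise_syndetic_unbounded:
  assumes "piecewise_syndetic A"
  shows "\<exists>m\<in>A. m \<ge> M"
proof -
  obtain k where "\<And>l. \<exists>x. \<forall>y\<in>{x..<x+l}. \<exists>j<k. y + j \<in> A"
    using assms unfolding piecewise_syndetic_def by blast
  then obtain x where "\<And>y. y \<in> {x..<x + Suc M} \<Longrightarrow> \<exists>j<k. y + j \<in> A" by blast
  from this[of "x + M"] obtain j where "x + M + j \<in> A" by auto
  then show ?thesis by (intro bexI[of _ "x + M + j"]) auto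
qed

text \<open>If \<open>B\<close> is not piecewise syndetic, then every long enough interval contains a window of length
  \<open>k\<close> without points of \<open>B\<close>.  Where \<open>A \<union> B\<close> meets all windows of length \<open>k\<close>, it is \<open>A\<close> that meets
  these ones.\<close>

lemma piecewise_syndetic_Un:
  assumes "piecewise_syndetic (A \<union> B)"
  shows "piecewise_syndetic A \<or> piecewise_syndetic B"
proof (rule disjCI)
  assume nB: "\<not> piecewise_syndetic B"
  obtain k where k: "\<And>l. \<exists>x. \<forall>y\<in>{x..<x+l}. \<exists>j<k. y + j \<in> A \<union> B"
    using assms unfolding piecewise_syndetic_def by blast
  obtain g where g: "\<And>x. \<exists>y\<in>{x..<x+g}. \<forall>j<k. y + j \<notin> B"
    using nB unfolding piecewise_syndetic_def by simp metis
  have "\<exists>x. \<forall>y\<in>{x..<x+l}. \<exists>j<g+k. y + j \<in> A" for l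
  proof -
    obtain x where x: "\<And>y. y \<in> {x..<x+(l+g)} \<Longrightarrow> \<exists>j<k. y + j \<in> A \<union> B" using k by blast
    have "\<exists>j<g+k. y + j \<in> A" if y: "y \<in> {x..<x+l}" for y
    proof -
      obtain z where z: "z \<in> {y..<y+g}" "\<And>j. j < k \<Longrightarrow> z + j \<notin> B" using g by blast
      have "z \<in> {x..<x+(l+g)}" using y z by auto
      from x[OF this] z(2) obtain j where j: "j < k" "z + j \<in> A" by blast
      have "y + (z - y + j) = z + j" "z - y + j < g + k" using z(1) j(1) by auto
      with j(2) show ?thesis by (intro exI[of _ "z - y + j"]) simp
    qed
    then show ?thesis by blast
  qed
  then show "piecewise_syndetic A" unfolding piecewise_syndetic_def by blast
qed

lemma not_piecewise_syndetic_empty: "\<not> piecewise_syndetic {}"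
  using piecewise_syndetic_unbounded[of "{}" 0] by blast

lemma piecewise_syndetic_UN:
  assumes "finite I" "piecewise_syndetic (\<Union>i\<in>I. A i)"
  shows "\<exists>i\<in>I. piecewise_syndetic (A i)"
  using assms
proof (induction I rule: finite_induct)
  case empty
  then show ?case using not_piecewise_syndetic_empty by simp
next
  case (insert i I)
  then show ?case using piecewise_syndetic_Un[of "A i" "\<Union>i\<in>I. A i"] by auto
qed

text \<open>A piecewise syndetic set is seen in one and the same way from all points of a piecewise
  syndetic set of observers: \<open>p i\<close> is the distance from \<open>x + i\<close> to some later point of \<open>A\<close>.  Every
  long enough window has one of finitely many such patterns.  The bound \<open>k\<close> on the distances does
  not depend on the length \<open>w\<close> of the window; so \<open>w\<close> may later be chosen in terms of \<open>k\<close>.\<close>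

lemma piecewise_syndetic_pattern:
  assumes "piecewise_syndetic A"
  shows "\<exists>k. \<forall>w. \<exists>p. (\<forall>i<w. p i < k) \<and> piecewise_syndetic {x. \<forall>i<w. x + i + p i \<in> A}"
proof -
  obtain k where k: "\<And>l. \<exists>x. \<forall>y\<in>{x..<x+l}. \<exists>j<k. y + j \<in> A"
    using assms unfolding piecewise_syndetic_def by blast
  have "\<exists>p. (\<forall>i<w. p i < k) \<and> piecewise_syndetic {x. \<forall>i<w. x + i + p i \<in> A}" for w
  proof -
    define T where "T = {x. \<forall>i<w. \<exists>j<k. x + i + j \<in> A}"
    have "piecewise_syndetic T"
      unfolding piecewise_syndetic_def
    proof (rule exI[of _ 1], rule allI)
      fix l
      obtain x where x: "\<And>y. y \<in> {x..<x+(l+w)} \<Longrightarrow> \<exists>j<k. y + j \<in> A" using k by blast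
      have "y \<in> T" if "y \<in> {x..<x+l}" for y
        using x[of "y + i" for i] that by (simp add: T_def)
      then show "\<exists>x. \<forall>y\<in>{x..<x+l}. \<exists>j<1. y + j \<in> T" by (intro exI[of _ x]) auto
    qed
    moreover have "T \<subseteq> (\<Union>p\<in>{..<w} \<rightarrow>\<^sub>E {..<k}. {x. \<forall>i<w. x + i + p i \<in> A})"
    proof
      fix x assume "x \<in> T"
      then have "\<forall>i\<in>{..<w}. \<exists>j. j < k \<and> x + i + j \<in> A" by (simp add: T_def)
      from bchoice[OF this] obtain p where p: "\<And>i. i < w \<Longrightarrow> p i < k \<and> x + i + p i \<in> A" by auto
      have "restrict p {..<w} \<in> {..<w} \<rightarrow>\<^sub>E {..<k}" using p by auto
      moreover have "x \<in> {x. \<forall>i<w. x + i + restrict p {..<w} i \<in> A}" using p by auto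
      ultimately show "x \<in> (\<Union>p\<in>{..<w} \<rightarrow>\<^sub>E {..<k}. {x. \<forall>i<w. x + i + p i \<in> A})" by blast
    qed
    ultimately have "piecewise_syndetic (\<Union>p\<in>{..<w} \<rightarrow>\<^sub>E {..<k}. {x. \<forall>i<w. x + i + p i \<in> A})"
      by (rule piecewise_syndetic_mono)
    then obtain p where "p \<in> {..<w} \<rightarrow>\<^sub>E {..<k}" "piecewise_syndetic {x. \<forall>i<w. x + i + p i \<in> A}"
      using piecewise_syndetic_UN[of "{..<w} \<rightarrow>\<^sub>E {..<k}"] by (auto intro: finite_PiE)
    then show ?thesis by (intro exI[of _ p]) auto
  qed
  then show ?thesis by blast
qed

section \<open>Return times of piecewise syndetic sets\<close>

definition returns :: "nat \<Rightarrow> nat \<Rightarrow> nat set \<Rightarrow> nat set" where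
  "returns L n B = {x. \<forall>k\<le>L. x + k * n \<in> B}"

text \<open>Van der Waerden's theorem for the product of the patterns of all sets in the family: a
  progression on which all patterns are constant has the same difference for all of them, while
  the observers may be at unrelated places.\<close>

lemma common_return_time:
  assumes fin: "finite \<B>" and ps: "\<And>B. B \<in> \<B> \<Longrightarrow> piecewise_syndetic B"
  shows "\<exists>n\<ge>1. \<forall>B\<in>\<B>. piecewise_syndetic (returns L n B)"
proof -
  obtain Bs where Bs: "set Bs = \<B>" using fin finite_list by blast
  have "\<forall>B\<in>\<B>. \<exists>k. \<forall>w. \<exists>p. (\<forall>i<w. p i < k) \<and> piecewise_syndetic {x. \<forall>i<w. x + i + p i \<in> B}"
    using piecewise_syndetic_pattern[OF ps] by blast
  from bchoice[OF this] obtain k where k: "\<forall>B\<in>\<B>. \<forall>w. \<exists>p. (\<forall>i<w. p i < k B) \<and>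
      piecewise_syndetic {x. \<forall>i<w. x + i + p i \<in> B}" ..
  define q where "q = Suc (\<Sum>B\<in>\<B>. k B)"
  have k_le: "k B < q" if "B \<in> \<B>" for B
    using member_le_sum[OF that _ fin, of k] by (simp add: q_def)
  define K where "K = (to_nat :: nat list \<Rightarrow> nat) ` {xs. set xs \<subseteq> {..<q} \<and> length xs = length Bs}"
  have "finite K" unfolding K_def using finite_lists_length_eq[of "{..<q}"] by blast
  then obtain W where W: "vdw_bound L K W" using van_der_Waerden by blast
  define w where "w = Suc (W + L * W)"
  have "\<forall>B\<in>\<B>. \<exists>p. (\<forall>i<w. p i < k B) \<and> piecewise_syndetic {x. \<forall>i<w. x + i + p i \<in> B}"
    using k by simp
  from bchoice[OF this] obtain p where p: "\<And>B i. B \<in> \<B> \<Longrightarrow> i < w \<Longrightarrow> p B i < k B"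
      "\<And>B. B \<in> \<B> \<Longrightarrow> piecewise_syndetic {x. \<forall>i<w. x + i + p B i \<in> B}"
    by auto
  \<comment> \<open>Outside the window the colour is arbitrary.\<close>
  define c where "c = (\<lambda>i. to_nat (map (\<lambda>B. if i < w then p B i else 0) Bs))"
  have "range c \<subseteq> K"
  proof -
    have "(if i < w then p B i else 0) < q" if "B \<in> \<B>" for B i
      using p(1)[OF that, of i] k_le[OF that] by auto
    then have "(\<lambda>B. if i < w then p B i else 0) ` \<B> \<subseteq> {..<q}" for i by blast
    then have "map (\<lambda>B. if i < w then p B i else 0) Bs
        \<in> {xs. set xs \<subseteq> {..<q} \<and> length xs = length Bs}" for i
      by (simp add: Bs)
    then show ?thesis unfolding c_def K_def by blast
  qed
  with W obtain i n where i: "i \<le> W" and n: "n \<in> {1..W}"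
    and cc: "\<And>j. j \<le> L \<Longrightarrow> c (i + j * n) = c i"
    unfolding vdw_bound_def by blast
  have inw: "i + j * n < w" if "j \<le> L" for j
    using mult_mono[of j L n W] i n that by (auto simp: w_def)
  have const: "p B (i + j * n) = p B i" if "B \<in> \<B>" "j \<le> L" for B j
    using cc[OF that(2)] inw[OF that(2)] inw[of 0] that(1) by (auto simp: c_def Bs)
  have "piecewise_syndetic (returns L n B)" if B: "B \<in> \<B>" for B
  proof (rule piecewise_syndetic_mono[OF piecewise_syndetic_translate[OF p(2)[OF B]]])
    show "(\<lambda>x. x + (i + p B i)) ` {x. \<forall>i<w. x + i + p B i \<in> B} \<subseteq> returns L n B"
    proof clarify
      fix x assume x: "\<forall>i<w. x + i + p B i \<in> B"
      have "x + (i + p B i) + j * n \<in> B" if j: "j \<le> L" for j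
      proof -
        have "x + (i + j * n) + p B (i + j * n) \<in> B" using x inw[OF j] by blast
        then show ?thesis using const[OF B j] by (simp add: ac_simps)
      qed
      then show "x + (i + p B i) \<in> returns L n B" by (simp add: returns_def)
    qed
  qed
  then show ?thesis using n by (intro exI[of _ n]) auto
qed

text \<open>With single sets \<open>B\<close> instead of finite families, the following notion would not visibly be
  partition regular: the two parts of \<open>S\<close> may fail on different sets.\<close>

definition recurrent :: "nat set \<Rightarrow> bool" where
  "recurrent S \<longleftrightarrow> (\<forall>\<B> L. finite \<B> \<longrightarrow> (\<forall>B\<in>\<B>. piecewise_syndetic B) \<longrightarrow>
     (\<exists>n\<in>S. n \<ge> 1 \<and> (\<forall>B\<in>\<B>. piecewise_syndetic (returns L n B))))"

lemma recurrent_UNIV: "recurrent UNIV"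
  unfolding recurrent_def using common_return_time by simp

text \<open>If one family has no return time in \<open>S\<close> and another has none in \<open>T\<close>, then their union has
  none in \<open>S \<union> T\<close>.\<close>

lemma recurrent_Un:
  assumes "recurrent (S \<union> T)"
  shows "recurrent S \<or> recurrent T"
proof (rule ccontr)
  assume "\<not> (recurrent S \<or> recurrent T)"
  then obtain \<A> L \<B> M where
    A: "finite \<A>" "\<forall>B\<in>\<A>. piecewise_syndetic B"
      "\<And>n. n \<in> S \<Longrightarrow> n \<ge> 1 \<Longrightarrow> \<exists>B\<in>\<A>. \<not> piecewise_syndetic (returns L n B)" and
    B: "finite \<B>" "\<forall>B\<in>\<B>. piecewise_syndetic B"
      "\<And>n. n \<in> T \<Longrightarrow> n \<ge> 1 \<Longrightarrow> \<exists>B\<in>\<B>. \<not> piecewise_syndetic (returns M n B)"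
    unfolding recurrent_def by metis
  have "finite (\<A> \<union> \<B>)" "\<forall>B\<in>\<A> \<union> \<B>. piecewise_syndetic B" using A B by auto
  with assms obtain n where n: "n \<in> S \<union> T" "n \<ge> 1"
      "\<And>B. B \<in> \<A> \<union> \<B> \<Longrightarrow> piecewise_syndetic (returns (max L M) n B)"
    unfolding recurrent_def by metis
  have "piecewise_syndetic (returns L n B)" "piecewise_syndetic (returns M n B)" if "B \<in> \<A> \<union> \<B>" for B
    using n(3)[OF that] by (auto elim!: piecewise_syndetic_mono simp: returns_def)
  with n A(3) B(3) show False by blast
qed

lemma recurrent_mono: "recurrent S \<Longrightarrow> S \<subseteq> T \<Longrightarrow> recurrent T"
  unfolding recurrent_def by (meson subsetD)

lemma recurrent_colour_class:
  fixes \<phi> :: "nat \<Rightarrow> 'c"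
  assumes "finite I" "\<phi> ` S \<subseteq> I" "recurrent S"
  shows "\<exists>i\<in>I. recurrent {n\<in>S. \<phi> n = i}"
  using assms
proof (induction I arbitrary: S rule: finite_induct)
  case empty
  then show ?case using recurrent_def[of "{}"] by force
next
  case (insert i I)
  have "S = {n\<in>S. \<phi> n = i} \<union> {n\<in>S. \<phi> n \<noteq> i}" by blast
  then consider "recurrent {n\<in>S. \<phi> n = i}" | "recurrent {n\<in>S. \<phi> n \<noteq> i}"
    using recurrent_Un insert.prems(2) by metis
  then show ?case
  proof cases
    case 2
    have "\<phi> ` {n\<in>S. \<phi> n \<noteq> i} \<subseteq> I" using insert.prems(1) by auto
    from insert.IH[OF this 2] obtain j where j: "j \<in> I" "recurrent {n\<in>{n\<in>S. \<phi> n \<noteq> i}. \<phi> n = j}" by blast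
    from j(2) have "recurrent {n\<in>S. \<phi> n = j}" by (rule recurrent_mono) blast
    with j(1) show ?thesis by blast
  qed blast
qed

section \<open>One more term of the sequence of exponents\<close>

text \<open>The colour of \<open>x ^ j * n\<close> becomes a function of \<open>j\<close> alone, as long as \<open>j\<close> is small compared to
  the index of a recurrent set that contains \<open>n\<close>.\<close>

lemma limit_colouring:
  fixes \<chi> :: "nat \<Rightarrow> 'c" and x :: nat
  assumes "finite I" "range \<chi> \<subseteq> I"
  shows "\<exists>c. range c \<subseteq> I \<and> (\<forall>m. recurrent {n. \<forall>j<m. \<chi> (x ^ j * n) = c j})"
proof -
  have "\<exists>S. \<forall>m. recurrent (S m) \<and> (S (Suc m) \<subseteq> S m \<and> (\<exists>i\<in>I. \<forall>n\<in>S (Suc m). \<chi> (x ^ m * n) = i))"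
  proof (rule dependent_nat_choice)
    show "\<exists>S. recurrent S" using recurrent_UNIV by blast
  next
    fix S m assume "recurrent S"
    then obtain i where "i \<in> I" "recurrent {n\<in>S. \<chi> (x ^ m * n) = i}"
      using recurrent_colour_class[of I "\<lambda>n. \<chi> (x ^ m * n)" S] assms by blast
    then show "\<exists>T. recurrent T \<and> T \<subseteq> S \<and> (\<exists>i\<in>I. \<forall>n\<in>T. \<chi> (x ^ m * n) = i)"
      by (intro exI[of _ "{n\<in>S. \<chi> (x ^ m * n) = i}"]) auto
  qed
  then obtain S c where S: "\<And>m. recurrent (S m)" "\<And>m. S (Suc m) \<subseteq> S m"
    and c: "\<And>m. c m \<in> I" "\<And>m n. n \<in> S (Suc m) \<Longrightarrow> \<chi> (x ^ m * n) = c m"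
    by metis
  have "S m \<subseteq> S (Suc j)" if "j < m" for j m
    using lift_Suc_antimono_le[of S "Suc j" m] S(2) that by simp
  then have "S m \<subseteq> {n. \<forall>j<m. \<chi> (x ^ j * n) = c j}" for m
    using c(2) by blast
  then have "recurrent {n. \<forall>j<m. \<chi> (x ^ j * n) = c j}" for m
    using S(1) recurrent_mono by blast
  with c(1) show ?thesis by blast
qed

text \<open>Here \<open>E\<close> stands for the set of all sums \<open>\<Sum> \<lambda>\<^sub>t b\<^sub>t\<close> formed so far, and \<open>G E\<close> says that the
  sequence can be continued: the \<open>m\<close> with \<open>m + E\<close> inside the class \<open>i\<close> of the limit colouring form
  a piecewise syndetic set.  The class \<open>i\<close> is fixed before any term is chosen.  The next term is
  \<open>b = x ^ m * n\<close>, where \<open>n\<close> is a return time for multiples up to \<open>L * x ^ m\<close>, because multiples of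
  \<open>b\<close> are multiples of \<open>n\<close>.\<close>

lemma exponent_extension:
  fixes \<chi> :: "nat \<Rightarrow> 'c" and x :: nat
  assumes I: "finite I" "range \<chi> \<subseteq> I" and x: "x \<ge> 2"
  obtains i G where "i \<in> I" "G {0}"
    "\<And>E L M. finite E \<Longrightarrow> G E \<Longrightarrow>
       \<exists>b>M. (\<forall>e\<in>E. \<chi> (b * x ^ e) = i) \<and> G ((\<lambda>(e, k). e + k * b) ` (E \<times> {..L}))"
proof -
  obtain c where c: "range c \<subseteq> I" "\<And>m. recurrent {n. \<forall>j<m. \<chi> (x ^ j * n) = c j}"
    using limit_colouring[OF I] by blast
  have "UNIV = (\<Union>i\<in>I. {m. c m = i})" using c(1) by auto
  then obtain i where i: "i \<in> I" "piecewise_syndetic {m. c m = i}"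
    using piecewise_syndetic_UN[OF I(1)] piecewise_syndetic_UNIV by metis
  define B where "B = (\<lambda>E. {m. \<forall>e\<in>E. c (m + e) = i})"
  show ?thesis
  proof
    show "i \<in> I" by fact
    show "piecewise_syndetic (B {0})" using i(2) by (simp add: B_def)
    fix E :: "nat set" and L M :: nat
    assume E: "finite E" "piecewise_syndetic (B E)"
    obtain m where m: "m \<in> B E" "m \<ge> M" using piecewise_syndetic_unbounded[OF E(2)] by blast
    define S where "S = {n. \<forall>j < m + Suc (Max (insert 0 E)). \<chi> (x ^ j * n) = c j}"
    have "recurrent S" unfolding S_def using c(2) .
    then have "finite {B E} \<longrightarrow> (\<forall>B\<in>{B E}. piecewise_syndetic B) \<longrightarrow>
        (\<exists>n\<in>S. n \<ge> 1 \<and> (\<forall>B\<in>{B E}. piecewise_syndetic (returns (L * x ^ m) n B)))"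
      unfolding recurrent_def by (elim allE)
    then obtain n where "n \<in> S" and n: "n \<ge> 1" "piecewise_syndetic (returns (L * x ^ m) n (B E))"
      using E(2) by auto
    define b where "b = x ^ m * n"
    have "m < x ^ m" using x by (intro power_gt_expt) simp
    also have "\<dots> \<le> b" using n(1) by (simp add: b_def)
    finally have "b > M" using m(2) by simp
    moreover have "\<chi> (b * x ^ e) = i" if e: "e \<in> E" for e
    proof -
      have "e \<le> Max (insert 0 E)" using E(1) e by simp
      then have "\<chi> (x ^ (m + e) * n) = c (m + e)" using \<open>n \<in> S\<close> by (simp add: S_def)
      also have "\<dots> = i" using m(1) e by (simp add: B_def)
      finally show ?thesis by (simp add: b_def power_add ac_simps)
    qed
    moreover have "returns (L * x ^ m) n (B E) \<subseteq> B ((\<lambda>(e, k). e + k * b) ` (E \<times> {..L}))"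
    proof
      fix z assume z: "z \<in> returns (L * x ^ m) n (B E)"
      have "c (z + (e + k * b)) = i" if "e \<in> E" "k \<le> L" for e k
      proof -
        have "z + (k * x ^ m) * n \<in> B E" using z that(2) unfolding returns_def by auto
        then show ?thesis using that(1) by (auto simp: B_def b_def ac_simps)
      qed
      then show "z \<in> B ((\<lambda>(e, k). e + k * b) ` (E \<times> {..L}))" by (auto simp: B_def)
    qed
    then have "piecewise_syndetic (B ((\<lambda>(e, k). e + k * b) ` (E \<times> {..L})))"
      using n(2) piecewise_syndetic_mono by blast
    ultimately show "\<exists>b>M. (\<forall>e\<in>E. \<chi> (b * x ^ e) = i) \<and>
        piecewise_syndetic (B ((\<lambda>(e, k). e + k * b) ` (E \<times> {..L})))" by blast
  qed
qed

section \<open>The infinite sequence\<close>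

text \<open>The bound \<open>g\<close> on the coefficient of a term is given as a function of the list of the earlier
  terms, so that it can be evaluated during the construction.\<close>

lemma monochromatic_exponents:
  fixes \<chi> :: "nat \<Rightarrow> 'c" and x :: nat and g :: "nat list \<Rightarrow> nat"
  assumes I: "finite I" "range \<chi> \<subseteq> I" and x: "x \<ge> 2"
  shows "\<exists>b. \<exists>i\<in>I. b 1 > 0 \<and> (\<forall>k\<ge>1. b k < b (Suc k)) \<and>
    (\<forall>k\<ge>1. \<forall>l. (\<forall>t\<in>{1..<k}. l t \<le> g (map b [1..<t])) \<longrightarrow>
       \<chi> (b k * x ^ (\<Sum>t\<in>{1..<k}. l t * b t)) = i)"
proof -
  obtain i G where i: "i \<in> I" and G0: "G {0}"
    and G: "\<And>E L M. finite E \<Longrightarrow> G E \<Longrightarrow>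
       \<exists>b>M. (\<forall>e\<in>E. \<chi> (b * x ^ e) = i) \<and> G ((\<lambda>(e, k). e + k * b) ` (E \<times> {..L}))"
    using exponent_extension[OF I x] by metis
  \<comment> \<open>The state after \<open>k\<close> steps: the list of the first \<open>k\<close> terms and the set of their sums.  The
    sum of the list is a convenient upper bound for its last element.\<close>
  define step where "step = (\<lambda>s s'. \<exists>b > sum_list (fst s). fst s' = fst s @ [b] \<and>
      (\<forall>e\<in>snd s. \<chi> (b * x ^ e) = i) \<and>
      snd s' = (\<lambda>(e, k). e + k * b) ` (snd s \<times> {..g (fst s)}))"
  define P where "P = (\<lambda>(k :: nat) (s :: nat list \<times> nat set). (k = 0 \<longrightarrow> s = ([], {0})) \<and> finite (snd s) \<and> G (snd s))"
  have "\<exists>s. \<forall>k. P k (s k) \<and> step (s k) (s (Suc k))"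
  proof (rule dependent_nat_choice)
    show "\<exists>s. P 0 s" by (auto simp: P_def G0)
  next
    fix s :: "nat list \<times> nat set" and k
    assume "P k s"
    then have E: "finite (snd s)" "G (snd s)" by (auto simp: P_def)
    from G[OF E, of "sum_list (fst s)" "g (fst s)"] obtain b where
      b: "b > sum_list (fst s)" "\<forall>e\<in>snd s. \<chi> (b * x ^ e) = i"
        "G ((\<lambda>(e, k). e + k * b) ` (snd s \<times> {..g (fst s)}))" by blast
    show "\<exists>s'. P (Suc k) s' \<and> step s s'"
      using b E by (intro exI[of _ "(fst s @ [b], (\<lambda>(e, k). e + k * b) ` (snd s \<times> {..g (fst s)}))"])
        (auto simp: P_def step_def)
  qed
  then obtain s where s0: "s 0 = ([], {0})" and step: "\<And>k. step (s k) (s (Suc k))"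
    by (auto simp: P_def)
  define b where "b = (\<lambda>k. last (fst (s k)))"
  have b: "b (Suc k) > sum_list (fst (s k))" "fst (s (Suc k)) = fst (s k) @ [b (Suc k)]"
      "\<forall>e\<in>snd (s k). \<chi> (b (Suc k) * x ^ e) = i"
      "snd (s (Suc k)) = (\<lambda>(e, j). e + j * b (Suc k)) ` (snd (s k) \<times> {..g (fst (s k))})" for k
    using step[of k] unfolding step_def b_def by auto
  have list: "fst (s k) = map b [1..<Suc k]" for k
    by (induction k) (simp_all add: s0 b(2))
  have sums: "(\<Sum>t\<in>{1..<Suc k}. l t * b t) \<in> snd (s k)"
    if "\<forall>t\<in>{1..<Suc k}. l t \<le> g (map b [1..<t])" for k l
    using that
  proof (induction k)
    case 0
    then show ?case by (simp add: s0)
  next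
    case (Suc k)
    have "l (Suc k) \<le> g (fst (s k))"
      using bspec[OF Suc.prems, of "Suc k"] unfolding list by fastforce
    moreover have "(\<Sum>t\<in>{1..<Suc k}. l t * b t) \<in> snd (s k)"
      by (rule Suc.IH) (use Suc.prems in auto)
    ultimately have "((\<Sum>t\<in>{1..<Suc k}. l t * b t), l (Suc k)) \<in> snd (s k) \<times> {..g (fst (s k))}"
      by blast
    then have "(\<Sum>t\<in>{1..<Suc k}. l t * b t) + l (Suc k) * b (Suc k) \<in> snd (s (Suc k))"
      unfolding b(4) by (rule rev_image_eqI) simp
    then show ?case by simp
  qed
  have "b 1 > 0" using b(1)[of 0] by simp
  moreover have "b k < b (Suc k)" if k: "k \<ge> 1" for k
  proof -
    obtain j where j: "k = Suc j" using k by (cases k) auto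
    have "b k \<le> sum_list (fst (s k))" using b(2)[of j] j by simp
    then show ?thesis using b(1)[of k] by simp
  qed
  moreover have "\<chi> (b k * x ^ (\<Sum>t\<in>{1..<k}. l t * b t)) = i"
    if k: "k \<ge> 1" and l: "\<forall>t\<in>{1..<k}. l t \<le> g (map b [1..<t])" for k l
  proof -
    obtain j where j: "k = Suc j" using k by (cases k) auto
    show ?thesis using sums[of j l] b(3)[of j] l unfolding j by blast
  qed
  ultimately show ?thesis using i by (intro exI[of _ b] bexI[of _ i]) auto
qed

section \<open>Monochromatic exponential sets\<close>

lemma mult_closed_power:
  assumes "mult_closed X" "x \<in> X" "n \<ge> 1"
  shows "x ^ n \<in> X"
  using assms(3)
proof (induction n rule: dec_induct)
  case base
  then show ?case using assms by simp
next
  case (step n)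
  then show ?case using assms by (simp add: mult_closed_def)
qed

theorem theorem2p10:
  fixes N r :: nat
    and f :: "nat \<Rightarrow> nat list \<Rightarrow> nat"
    and C :: "nat \<Rightarrow> nat set"
    and X :: "nat set"
  assumes "N \<in> pos_nats"
    and "function_sequence f"
    and "finite_coloring r C"
    and "X \<subseteq> pos_nats"
    and "mult_closed X"
    and "nontrivial X"
  shows "\<exists>a. (\<forall>n\<ge>1. a n \<in> pos_nats) \<and> strict_mono_on {1..} a \<and>
           (\<exists>i\<in>{1..r}. FE N f a \<subseteq> X \<inter> C i)"
proof -
  obtain x where x: "x \<in> X" "x \<ge> 2"
  proof -
    obtain x where "x \<in> X" "x \<noteq> 1" using assms(6) unfolding nontrivial_def by blast
    moreover from this have "x > 0" using assms(4) by auto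
    ultimately show ?thesis using that[of x] by simp
  qed
  have "\<exists>i\<in>{1..r}. x ^ y \<in> C i" for y
  proof -
    have "x ^ y \<in> pos_nats" using x(2) by simp
    then show ?thesis using assms(3) unfolding finite_coloring_def by blast
  qed
  then obtain \<chi> where \<chi>: "\<And>y. \<chi> y \<in> {1..r}" "\<And>y. x ^ y \<in> C (\<chi> y)" by metis
  define g where "g = (\<lambda>bs. if bs = [] then N else f (Suc (length bs)) (map (\<lambda>b. x ^ b) bs))"
  have "range \<chi> \<subseteq> {1..r}" using \<chi>(1) by blast
  from monochromatic_exponents[OF finite_atLeastAtMost this x(2), of g]
  obtain b i where i: "i \<in> {1..r}" and b1: "b 1 > 0" and inc: "\<And>k. k \<ge> 1 \<Longrightarrow> b k < b (Suc k)"
    and col: "\<And>k l. k \<ge> 1 \<Longrightarrow> (\<And>t. t \<in> {1..<k} \<Longrightarrow> l t \<le> g (map b [1..<t])) \<Longrightarrow>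
       \<chi> (b k * x ^ (\<Sum>t\<in>{1..<k}. l t * b t)) = i"
    by metis
  define a where "a = (\<lambda>k. x ^ b k)"
  have b_pos: "b k \<ge> 1" if "k \<ge> 1" for k
    using that
  proof (induction k rule: dec_induct)
    case base
    then show ?case using b1 by simp
  next
    case (step k)
    then show ?case using inc[of k] by simp
  qed
  have "b m < b n" if "1 \<le> m" "m < n" for m n
    using that(2,1) by (induction rule: strict_inc_induct) (use inc in \<open>auto intro: less_trans\<close>)
  then have mono: "strict_mono_on {1..} a"
    using x(2) by (auto simp: strict_mono_on_def a_def)
  have key: "a k ^ (\<Prod>t\<in>{1..<k}. a t ^ l t) \<in> X \<inter> C i"
    if k: "k \<ge> 1" and l: "\<And>t. t \<in> {1..<k} \<Longrightarrow> l t \<le> g (map b [1..<t])" for k l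
  proof -
    define y where "y = b k * x ^ (\<Sum>t\<in>{1..<k}. l t * b t)"
    have "(\<Prod>t\<in>{1..<k}. a t ^ l t) = x ^ (\<Sum>t\<in>{1..<k}. l t * b t)"
      by (simp add: a_def power_sum mult.commute flip: power_mult)
    then have eq: "a k ^ (\<Prod>t\<in>{1..<k}. a t ^ l t) = x ^ y"
      by (simp add: a_def y_def power_mult)
    have "y \<ge> 1" using b_pos[OF k] x(2) by (simp add: y_def)
    then have "x ^ y \<in> X" using mult_closed_power assms(5) x(1) by blast
    moreover have "x ^ y \<in> C i" using \<chi>(2)[of y] col[of k l] k l by (simp add: y_def)
    ultimately show ?thesis using eq by simp
  qed
  have g: "g (map b [1..<t]) = (if t = 1 then N else f t (map a [1..<t]))" if "t \<ge> 1" for t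
    using that by (auto simp: g_def a_def o_def)
  have "EXP N f a k \<subseteq> X \<inter> C i" if k: "k \<ge> 1" for k
  proof (cases "k = 1")
    case True
    then show ?thesis using key[of 1 "\<lambda>_. 0"] by (simp add: EXP_def)
  next
    case False
    have iv: "{1..k-1} = {1..<k}" using k by auto
    show ?thesis
    proof
      fix z assume "z \<in> EXP N f a k"
      then obtain l where z: "z = a k ^ (\<Prod>t\<in>{1..<k}. a t ^ l t)" and l1: "l 1 \<le> N"
        and l2: "\<And>t. t \<in> {2..k-1} \<Longrightarrow> l t \<le> f t (map a [1..<t])"
        using False unfolding EXP_def iv by auto
      have "l t \<le> g (map b [1..<t])" if "t \<in> {1..<k}" for t
        using l1 l2[of t] that g[of t] by (cases "t = 1") auto
      then show "z \<in> X \<inter> C i" using key[OF k] z by blast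
    qed
  qed
  then have "FE N f a \<subseteq> X \<inter> C i" unfolding FE_def by blast
  moreover have "\<forall>n\<ge>1. a n \<in> pos_nats" using x(2) by (simp add: a_def)
  ultimately show ?thesis using mono i by blast
qed

end
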